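(* Let $f_1$ be a solution of $\partial_{\bar z}\psi=u\bar\psi$ in $D$ and $f_1^+$ a solution of $\partial_{\bar z}\psi^+=-\bar u\,\overline{\psi^+}$ in $D$, and let $\omega_{f_1,f_1^+}$ be a potential with $\omega_{f_1,f_1^+}\neq0$ in $D$. Let $\mathcal{M}_1$ be the simple Moutard transform $$\tilde u=u+\frac{f_1\overline{f_1^+}}{\omega_{f_1,f_1^+}},\qquad \tilde\psi=\psi-f_1\frac{\omega_{\psi,f_1^+}}{\omega_{f_1,f_1^+}},\qquad \tilde\psi^+=\psi^+-f_1^+\frac{\omega_{f_1,\psi^+}}{\omega_{f_1,f_1^+}},$$ where $\psi,\psi^+$ are arbitrary solutions of the two equations with coefficient $u$. Put $$\tilde f_2=\hat f=-i\frac{f_1}{\omega_{f_1,f_1^+}},\qquad \tilde f_2^+=\hat f^+=-i\frac{f_1^+}{\omega_{f_1,f_1^+}},$$ which are solutions of $\partial_{\bar z}\tilde\psi=\tilde u\,\overline{\tilde\psi}$ and $\partial_{\bar z}\tilde\psi^+=-\overline{\tilde u}\,\overline{\tilde\psi^+}$, respectively. Let $\mathcal{M}_2$ be the simple Moutard transform for the equations with coefficient $\tilde u$ generated by $\tilde f_2,\tilde f_2^+$: $$\tilde{\tilde u}=\tilde u+\frac{\tilde f_2\overline{\tilde f_2^+}}{\omega_{\tilde f_2,\tilde f_2^+}},\qquad \tilde{\tilde\psi}=\tilde\psi-\tilde f_2\frac{\omega_{\tilde\psi,\tilde f_2^+}}{\omega_{\tilde f_2,\tilde f_2^+}},\qquad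 \tilde{\tilde\psi}^+=\tilde\psi^+-\tilde f_2^+\frac{\omega_{\tilde f_2,\tilde\psi^+}}{\omega_{\tilde f_2,\tilde f_2^+}}.$$ Then: 1. The potentials $\omega_{\tilde\psi,\tilde f_2^+}$, $\omega_{\tilde f_2,\tilde\psi^+}$, $\omega_{\tilde f_2,\tilde f_2^+}$ can be chosen as $$\omega_{\tilde\psi,\tilde f_2^+}=-i\frac{\omega_{\psi,f_1^+}}{\omega_{f_1,f_1^+}},\qquad \omega_{\tilde f_2,\tilde\psi^+}=-i\frac{\omega_{f_1,\psi^+}}{\omega_{f_1,f_1^+}},\qquad \omega_{\tilde f_2,\tilde f_2^+}=\frac{1}{\omega_{f_1,f_1^+}}.$$ 2. With this choice of potentials, the composition $\mathcal{M}=\mathcal{M}_2\circ\mathcal{M}_1$ is the identity transformation: $\tilde{\tilde u}=u$, $\tilde{\tilde\psi}=\psi$, $\tilde{\tilde\psi}^+=\psi^+$.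
   Context: $D\subset\mathbb{C}$ is an open connected set, $u=u(z)$ is a complex-valued function on $D$ (not assumed holomorphic), $\partial_z=\partial/\partial z$ and $\partial_{\bar z}=\partial/\partial\bar z$ are the Wirtinger derivatives. Generalized analytic functions are solutions $\psi$ of $\partial_{\bar z}\psi=u\bar\psi$ in $D$; the conjugate equation is $\partial_{\bar z}\psi^+=-\bar u\,\overline{\psi^+}$ in $D$. All functions are complex-valued and as regular as needed for the derivatives to make classical sense (e.g. real-differentiable). For solutions $\psi,\psi^+$ of these two equations, $\omega_{\psi,\psi^+}$ denotes a potential of the pair: a purely imaginary-valued function on $D$ with $\partial_z\omega_{\psi,\psi^+}=\psi\psi^+$ and $\partial_{\bar z}\omega_{\psi,\psi^+}=-\overline{\psi\psi^+}$ in $D$. It is unique up to an additive imaginary constant; the potentials $\omega_{f_1,f_1^+}$, $\omega_{\psi,f_1^+}$, $\omega_{f_1,\psi^+}$ are assumed to exist (e.g. $D$ is simply connected), and for each pair one choice is fixed and used throughout. The same definition of potential is used for pairs of solutions of the transformed equations $\partial_{\bar z}\tilde\psi=\tilde u\,\overline{\tilde\psi}$, $\partial_{\bar z}\tilde\psi^+=-\overline{\tilde u}\,\overline{\tilde\psi^+}$ with coefficient $\tilde u$. *)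

theory Defs
  imports "HOL-Analysis.Analysis"
begin

text \<open>Wirtinger derivatives \<open>(\<partial>\<^sub>x - i \<partial>\<^sub>y) / 2\<close> and \<open>(\<partial>\<^sub>x + i \<partial>\<^sub>y) / 2\<close>. The Frechet derivative on type
  \<^typ>\<open>complex\<close> is the real-linear one, so its values at \<open>1\<close> and \<open>\<i>\<close> are the partial derivatives
  with respect to \<open>x\<close> and \<open>y\<close>; likewise \<^const>\<open>differentiable\<close> below means real-differentiable.
  The values are only meaningful at points of differentiability.\<close>

definition dz :: "(complex \<Rightarrow> complex) \<Rightarrow> complex \<Rightarrow> complex" where
  "dz f z = (frechet_derivative f (at z) 1 - \<i> * frechet_derivative f (at z) \<i>) / 2"

definition dzbar :: "(complex \<Rightarrow> complex) \<Rightarrow> complex \<Rightarrow> complex" where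
  "dzbar f z = (frechet_derivative f (at z) 1 + \<i> * frechet_derivative f (at z) \<i>) / 2"

definition gen_analytic :: "complex set \<Rightarrow> (complex \<Rightarrow> complex) \<Rightarrow> (complex \<Rightarrow> complex) \<Rightarrow> bool" where
  "gen_analytic D u \<psi> \<longleftrightarrow>
     (\<forall>z\<in>D. \<psi> differentiable (at z) \<and> dzbar \<psi> z = u z * cnj (\<psi> z))"

definition conj_gen_analytic :: "complex set \<Rightarrow> (complex \<Rightarrow> complex) \<Rightarrow> (complex \<Rightarrow> complex) \<Rightarrow> bool" where
  "conj_gen_analytic D u \<psi>p \<longleftrightarrow>
     (\<forall>z\<in>D. \<psi>p differentiable (at z) \<and> dzbar \<psi>p z = - cnj (u z) * cnj (\<psi>p z))"

definition is_potential ::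
  "complex set \<Rightarrow> (complex \<Rightarrow> complex) \<Rightarrow> (complex \<Rightarrow> complex) \<Rightarrow> (complex \<Rightarrow> complex) \<Rightarrow> bool" where
  "is_potential D \<psi> \<psi>p \<omega> \<longleftrightarrow>
     (\<forall>z\<in>D. \<omega> differentiable (at z) \<and> Re (\<omega> z) = 0 \<and>
            dz \<omega> z = \<psi> z * \<psi>p z \<and> dzbar \<omega> z = - cnj (\<psi> z * \<psi>p z))"

text \<open>The simple Moutard transform generated by \<open>f\<close>, \<open>fp\<close> with potential \<open>\<omega>\<close> of the pair \<open>(f, fp)\<close>.
  A potential is determined only up to an additive constant, so the chosen potential
  \<open>\<omega>\<psi>\<close> of \<open>(\<psi>, fp)\<close>, respectively \<open>\<omega>\<psi>p\<close> of \<open>(f, \<psi>p)\<close>, is an explicit argument.\<close>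

definition moutard_coeff ::
  "(complex \<Rightarrow> complex) \<Rightarrow> (complex \<Rightarrow> complex) \<Rightarrow> (complex \<Rightarrow> complex) \<Rightarrow>
   (complex \<Rightarrow> complex) \<Rightarrow> complex \<Rightarrow> complex" where
  "moutard_coeff f fp \<omega> u z = u z + f z * cnj (fp z) / \<omega> z"

definition moutard_sol ::
  "(complex \<Rightarrow> complex) \<Rightarrow> (complex \<Rightarrow> complex) \<Rightarrow> (complex \<Rightarrow> complex) \<Rightarrow>
   (complex \<Rightarrow> complex) \<Rightarrow> complex \<Rightarrow> complex" where
  "moutard_sol f \<omega> \<omega>\<psi> \<psi> z = \<psi> z - f z * (\<omega>\<psi> z / \<omega> z)"

definition moutard_conj_sol ::
  "(complex \<Rightarrow> complex) \<Rightarrow> (complex \<Rightarrow> complex) \<Rightarrow> (complex \<Rightarrow> complex) \<Rightarrow>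
   (complex \<Rightarrow> complex) \<Rightarrow> complex \<Rightarrow> complex" where
  "moutard_conj_sol fp \<omega> \<omega>\<psi>p \<psi>p z = \<psi>p z - fp z * (\<omega>\<psi>p z / \<omega> z)"

end

theory Submission
  imports Defs
begin

text \<open>
  The Moutard transform has one computational core, \<open>moutard_step\<close>: it sends a solution \<open>\<psi>\<close>
  with potential \<open>a\<close> of the pair \<open>(\<psi>, fp)\<close> to a solution of the transformed equation, and
  \<open>-\<i> a / \<omega>\<close> is a potential of the image paired with \<open>-\<i> fp / \<omega>\<close>. The calculation uses the
  Leibniz rules for the Wirtinger derivatives and \<open>cnj (a / \<omega>) = a / \<omega>\<close>, which holds because
  potentials are imaginary.

  Everything about derivatives is an instance of this core. The zero solution has the
  constant \<open>\<i>\<close> as a potential, and its transform is \<open>-\<i> f / \<omega>\<close>, with potential \<open>1 / \<omega>\<close>: these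
  are precisely the generators of the inverse transform. The conjugate equation with coefficient
  \<open>u\<close> is the original equation with coefficient \<open>- cnj u\<close>, and passing to \<open>- cnj u\<close> commutes
  with the transform once the two generators are exchanged; this gives the conjugate half.

  That the second transform undoes the first is then algebra. The generators satisfy
  \<open>f2 * cnj f2p / \<omega>22 = - f1 * cnj f1p / \<omega>11\<close>, so the correction to the coefficient cancels, and
  \<open>f2 * ((-\<i> a / \<omega>11) / \<omega>22) = - f1 * (a / \<omega>11)\<close>, so the correction to the solution does too.
\<close>

section \<open>Calculus of Wirtinger derivatives\<close>

lemma wirtinger_of_has_derivative:
  assumes "(f has_derivative f') (at z)"
  shows "dz f z = (f' 1 - \<i> * f' \<i>) / 2" and "dzbar f z = (f' 1 + \<i> * f' \<i>) / 2"
  using frechet_derivative_at[OF assms] by (simp_all add: dz_def dzbar_def)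

lemma wirtinger_const: "dz (\<lambda>z. c) z = 0" "dzbar (\<lambda>z. c) z = 0"
  by (simp_all add: dz_def dzbar_def)

lemma wirtinger_diff:
  assumes "f differentiable (at z)" and "g differentiable (at z)"
  shows "dz (\<lambda>z. f z - g z) z = dz f z - dz g z"
    and "dzbar (\<lambda>z. f z - g z) z = dzbar f z - dzbar g z"
  unfolding wirtinger_of_has_derivative
    [OF has_derivative_diff[OF assms[unfolded frechet_derivative_works]]]
  by (simp_all add: dz_def dzbar_def field_simps)

lemma wirtinger_mult:
  assumes "f differentiable (at z)" and "g differentiable (at z)"
  shows "dz (\<lambda>z. f z * g z) z = dz f z * g z + f z * dz g z"
    and "dzbar (\<lambda>z. f z * g z) z = dzbar f z * g z + f z * dzbar g z"
  unfolding wirtinger_of_has_derivative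
    [OF has_derivative_mult[OF assms[unfolded frechet_derivative_works]]]
  by (simp_all add: dz_def dzbar_def field_simps)

lemma wirtinger_divide:
  assumes "f differentiable (at z)" and "g differentiable (at z)" and "g z \<noteq> 0"
  shows "dz (\<lambda>z. f z / g z) z = dz f z / g z - f z * dz g z / (g z)\<^sup>2"
    and "dzbar (\<lambda>z. f z / g z) z = dzbar f z / g z - f z * dzbar g z / (g z)\<^sup>2"
  unfolding wirtinger_of_has_derivative
    [OF has_derivative_divide'[OF assms(1,2)[unfolded frechet_derivative_works] assms(3)]]
  using assms(3) by (simp_all add: dz_def dzbar_def field_simps power2_eq_square)

section \<open>One Moutard step\<close>

lemma cnj_imaginary: "Re w = 0 \<Longrightarrow> cnj w = - w"
  by (simp add: complex_eq_iff)

text \<open>For the equation, differentiating \<open>a / \<omega>\<close> yields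
  \<open>dzbar (a / \<omega>) = - cnj fp * (cnj \<psi> - cnj f * (a / \<omega>)) / \<omega>\<close>; as \<open>a / \<omega>\<close> is real, the bracket is
  the conjugate of the transformed solution. So the extra term \<open>- f * dzbar (a / \<omega>)\<close> is exactly
  the change \<open>f * cnj fp / \<omega>\<close> of the coefficient times that conjugate. The same formula and its
  conjugate, multiplied by \<open>- \<i>\<close>, show that \<open>- \<i> * (a / \<omega>)\<close> is the new potential.\<close>

lemma moutard_step:
  assumes f: "gen_analytic D u f" and \<omega>: "is_potential D f fp \<omega>" and nz: "\<forall>z\<in>D. \<omega> z \<noteq> 0"
    and \<psi>: "gen_analytic D u \<psi>" and a: "is_potential D \<psi> fp a"
  shows moutard_sol_gen_analytic:
      "gen_analytic D (moutard_coeff f fp \<omega> u) (moutard_sol f \<omega> a \<psi>)"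
    and moutard_sol_potential:
      "is_potential D (moutard_sol f \<omega> a \<psi>) (\<lambda>z. - \<i> * (fp z / \<omega> z)) (\<lambda>z. - \<i> * (a z / \<omega> z))"
proof -
  have sol: "moutard_sol f \<omega> a \<psi> = (\<lambda>z. \<psi> z - f z * (a z / \<omega> z))"
    by (simp add: moutard_sol_def fun_eq_iff)
  have pt: "moutard_sol f \<omega> a \<psi> differentiable (at z)
      \<and> dzbar (moutard_sol f \<omega> a \<psi>) z = moutard_coeff f fp \<omega> u z * cnj (moutard_sol f \<omega> a \<psi> z)
      \<and> (\<lambda>z. - \<i> * (a z / \<omega> z)) differentiable (at z) \<and> Re (- \<i> * (a z / \<omega> z)) = 0
      \<and> dz (\<lambda>z. - \<i> * (a z / \<omega> z)) z = moutard_sol f \<omega> a \<psi> z * (- \<i> * (fp z / \<omega> z))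
      \<and> dzbar (\<lambda>z. - \<i> * (a z / \<omega> z)) z = - cnj (moutard_sol f \<omega> a \<psi> z * (- \<i> * (fp z / \<omega> z)))"
    if z: "z \<in> D" for z
  proof -
    have d: "f differentiable (at z)" "\<psi> differentiable (at z)"
        "\<omega> differentiable (at z)" "a differentiable (at z)"
      and eqs: "dzbar f z = u z * cnj (f z)" "dzbar \<psi> z = u z * cnj (\<psi> z)"
        "dz \<omega> z = f z * fp z" "dzbar \<omega> z = - cnj (f z * fp z)"
        "dz a z = \<psi> z * fp z" "dzbar a z = - cnj (\<psi> z * fp z)"
      and c: "cnj (\<omega> z) = - \<omega> z" "cnj (a z) = - a z"
      and nz: "\<omega> z \<noteq> 0"
      using f \<omega> nz \<psi> a z by (auto simp: gen_analytic_def is_potential_def cnj_imaginary)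
    have dq: "(\<lambda>z. a z / \<omega> z) differentiable (at z)"
      using d nz by (intro differentiable_divide)
    have dp: "(\<lambda>z. f z * (a z / \<omega> z)) differentiable (at z)"
      using d dq by (intro differentiable_mult)
    have "cnj (a z / \<omega> z) = a z / \<omega> z"
      by (simp add: c)
    then have "Im (a z / \<omega> z) = 0"
      by (metis cnj.sel(2) neg_equal_zero)
    then have im: "Re (- \<i> * (a z / \<omega> z)) = 0"
      by (simp del: times_divide_eq_right)
    note rules = wirtinger_diff[OF d(2) dp] wirtinger_mult[OF d(1) dq]
      wirtinger_mult[OF differentiable_const dq] wirtinger_divide[OF d(4,3) nz] wirtinger_const
    have sol_eq: "dzbar (moutard_sol f \<omega> a \<psi>) z
        = moutard_coeff f fp \<omega> u z * cnj (moutard_sol f \<omega> a \<psi> z)"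
      unfolding sol moutard_coeff_def rules eqs
      using nz by (simp add: c field_simps power2_eq_square)
    have pot_dz: "dz (\<lambda>z. - \<i> * (a z / \<omega> z)) z
        = moutard_sol f \<omega> a \<psi> z * (- \<i> * (fp z / \<omega> z))"
      unfolding sol rules eqs
      using nz by (simp add: c field_simps power2_eq_square)
    have pot_dzbar: "dzbar (\<lambda>z. - \<i> * (a z / \<omega> z)) z
        = - cnj (moutard_sol f \<omega> a \<psi> z * (- \<i> * (fp z / \<omega> z)))"
      unfolding sol rules eqs
      using nz by (simp add: c field_simps power2_eq_square)
    have "moutard_sol f \<omega> a \<psi> differentiable (at z)"
      unfolding sol using d(2) dp by (intro differentiable_diff)
    moreover have "(\<lambda>z. - \<i> * (a z / \<omega> z)) differentiable (at z)"
      using dq by (intro differentiable_mult differentiable_const)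
    ultimately show ?thesis
      using im sol_eq pot_dz pot_dzbar by blast
  qed
  show "gen_analytic D (moutard_coeff f fp \<omega> u) (moutard_sol f \<omega> a \<psi>)"
    using pt unfolding gen_analytic_def by blast
  show "is_potential D (moutard_sol f \<omega> a \<psi>) (\<lambda>z. - \<i> * (fp z / \<omega> z)) (\<lambda>z. - \<i> * (a z / \<omega> z))"
    using pt unfolding is_potential_def by blast
qed

text \<open>The generators of the inverse transform are the transform of the zero solution, for the
  nonzero constant potential \<open>\<i>\<close>.\<close>

lemma moutard_inverse_generator:
  assumes "gen_analytic D u f" and "is_potential D f fp \<omega>" and "\<forall>z\<in>D. \<omega> z \<noteq> 0"
  shows "gen_analytic D (moutard_coeff f fp \<omega> u) (\<lambda>z. - \<i> * (f z / \<omega> z))"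
    and "is_potential D (\<lambda>z. - \<i> * (f z / \<omega> z)) (\<lambda>z. - \<i> * (fp z / \<omega> z)) (\<lambda>z. 1 / \<omega> z)"
proof -
  have zero: "gen_analytic D u (\<lambda>z. 0)" "is_potential D (\<lambda>z. 0) fp (\<lambda>z. \<i>)"
    by (simp_all add: gen_analytic_def is_potential_def wirtinger_const)
  have sol: "moutard_sol f \<omega> (\<lambda>z. \<i>) (\<lambda>z. 0) = (\<lambda>z. - \<i> * (f z / \<omega> z))"
    by (simp add: moutard_sol_def fun_eq_iff)
  have pot: "(\<lambda>z. - \<i> * (\<i> / \<omega> z)) = (\<lambda>z. 1 / \<omega> z)"
    by (simp add: fun_eq_iff)
  show "gen_analytic D (moutard_coeff f fp \<omega> u) (\<lambda>z. - \<i> * (f z / \<omega> z))"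
    using moutard_sol_gen_analytic[OF assms zero] by (simp only: sol)
  show "is_potential D (\<lambda>z. - \<i> * (f z / \<omega> z)) (\<lambda>z. - \<i> * (fp z / \<omega> z)) (\<lambda>z. 1 / \<omega> z)"
    using moutard_sol_potential[OF assms zero] by (simp only: sol pot)
qed

section \<open>Duality with the conjugate equation\<close>

lemma conj_gen_analytic_iff: "conj_gen_analytic D u \<psi> \<longleftrightarrow> gen_analytic D (\<lambda>z. - cnj (u z)) \<psi>"
  by (simp add: conj_gen_analytic_def gen_analytic_def)

lemma is_potential_commute: "is_potential D \<psi> \<psi>p \<omega> \<longleftrightarrow> is_potential D \<psi>p \<psi> \<omega>"
  by (simp add: is_potential_def mult.commute)

lemma moutard_conj_sol_eq: "moutard_conj_sol = moutard_sol"
  by (simp add: moutard_conj_sol_def moutard_sol_def fun_eq_iff)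

text \<open>The sign in \<open>- cnj u\<close> is matched by the sign in \<open>cnj \<omega> = - \<omega>\<close>.\<close>

lemma conj_gen_analytic_moutard_coeff:
  assumes "is_potential D f fp \<omega>"
  shows "conj_gen_analytic D (moutard_coeff f fp \<omega> u) \<psi>
    \<longleftrightarrow> gen_analytic D (moutard_coeff fp f \<omega> (\<lambda>z. - cnj (u z))) \<psi>"
proof -
  have "moutard_coeff fp f \<omega> (\<lambda>z. - cnj (u z)) z = - cnj (moutard_coeff f fp \<omega> u z)"
    if "z \<in> D" for z
    using assms that by (simp add: is_potential_def cnj_imaginary moutard_coeff_def)
  then show ?thesis
    by (simp add: conj_gen_analytic_iff gen_analytic_def)
qed

section \<open>The inverse transform\<close>

lemma moutard_coeff_inverse:
  assumes "is_potential D f fp \<omega>" and "z \<in> D" and "\<omega> z \<noteq> 0"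
  shows "moutard_coeff (\<lambda>z. - \<i> * (f z / \<omega> z)) (\<lambda>z. - \<i> * (fp z / \<omega> z)) (\<lambda>z. 1 / \<omega> z)
    (moutard_coeff f fp \<omega> u) z = u z"
  using assms by (simp add: is_potential_def cnj_imaginary moutard_coeff_def field_simps)

lemma moutard_sol_inverse:
  assumes "\<omega> z \<noteq> 0"
  shows "moutard_sol (\<lambda>z. - \<i> * (f z / \<omega> z)) (\<lambda>z. 1 / \<omega> z) (\<lambda>z. - \<i> * (a z / \<omega> z))
    (moutard_sol f \<omega> a \<psi>) z = \<psi> z"
  using assms by (simp add: moutard_sol_def field_simps)

theorem theorem2:
  fixes D :: "complex set"
    and u f1 f1p \<omega>11 :: "complex \<Rightarrow> complex"
    and u1 f2 f2p \<omega>22 :: "complex \<Rightarrow> complex"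
  assumes "open D" and "connected D"
    and "gen_analytic D u f1" and "conj_gen_analytic D u f1p"
    and "is_potential D f1 f1p \<omega>11" and "\<forall>z\<in>D. \<omega>11 z \<noteq> 0"
    and u1: "u1 = moutard_coeff f1 f1p \<omega>11 u"
    and f2: "f2 = (\<lambda>z. - \<i> * (f1 z / \<omega>11 z))"
    and f2p: "f2p = (\<lambda>z. - \<i> * (f1p z / \<omega>11 z))"
    and \<omega>22: "\<omega>22 = (\<lambda>z. 1 / \<omega>11 z)"
  shows "gen_analytic D u1 f2 \<and> conj_gen_analytic D u1 f2p
    \<and> is_potential D f2 f2p \<omega>22 \<and> (\<forall>z\<in>D. \<omega>22 z \<noteq> 0)
    \<and> (\<forall>z\<in>D. moutard_coeff f2 f2p \<omega>22 u1 z = u z)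
    \<and> (\<forall>\<psi> \<omega>\<psi>. gen_analytic D u \<psi> \<and> is_potential D \<psi> f1p \<omega>\<psi> \<longrightarrow>
         (let \<psi>1 = moutard_sol f1 \<omega>11 \<omega>\<psi> \<psi>;
              \<omega>\<psi>1 = (\<lambda>z. - \<i> * (\<omega>\<psi> z / \<omega>11 z))
          in gen_analytic D u1 \<psi>1
             \<and> is_potential D \<psi>1 f2p \<omega>\<psi>1
             \<and> (\<forall>z\<in>D. moutard_sol f2 \<omega>22 \<omega>\<psi>1 \<psi>1 z = \<psi> z)))
    \<and> (\<forall>\<psi>p \<omega>\<psi>p. conj_gen_analytic D u \<psi>p \<and> is_potential D f1 \<psi>p \<omega>\<psi>p \<longrightarrow>
         (let \<psi>p1 = moutard_conj_sol f1p \<omega>11 \<omega>\<psi>p \<psi>p;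
              \<omega>\<psi>p1 = (\<lambda>z. - \<i> * (\<omega>\<psi>p z / \<omega>11 z))
          in conj_gen_analytic D u1 \<psi>p1
             \<and> is_potential D f2 \<psi>p1 \<omega>\<psi>p1
             \<and> (\<forall>z\<in>D. moutard_conj_sol f2p \<omega>22 \<omega>\<psi>p1 \<psi>p1 z = \<psi>p z)))"
proof -
  note f1 = assms(3) and \<omega> = assms(5) and nz = assms(6)
  note f1p = assms(4)[unfolded conj_gen_analytic_iff]
  note \<omega>' = \<omega>[unfolded is_potential_commute[of D f1]]
  note dual = conj_gen_analytic_moutard_coeff[OF \<omega>]
  have "gen_analytic D u1 f2" "is_potential D f2 f2p \<omega>22"
    unfolding u1 f2 f2p \<omega>22 using moutard_inverse_generator[OF f1 \<omega> nz] .
  moreover have "conj_gen_analytic D u1 f2p"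
    unfolding u1 f2p dual using moutard_inverse_generator(1)[OF f1p \<omega>' nz] .
  moreover have "\<forall>z\<in>D. \<omega>22 z \<noteq> 0"
    using nz by (simp add: \<omega>22)
  moreover have "\<forall>z\<in>D. moutard_coeff f2 f2p \<omega>22 u1 z = u z"
    unfolding u1 f2 f2p \<omega>22 using moutard_coeff_inverse[OF \<omega>] nz by blast
  moreover have "gen_analytic D u1 (moutard_sol f1 \<omega>11 a \<psi>)
      \<and> is_potential D (moutard_sol f1 \<omega>11 a \<psi>) f2p (\<lambda>z. - \<i> * (a z / \<omega>11 z))
      \<and> (\<forall>z\<in>D. moutard_sol f2 \<omega>22 (\<lambda>z. - \<i> * (a z / \<omega>11 z)) (moutard_sol f1 \<omega>11 a \<psi>) z = \<psi> z)"
    if "gen_analytic D u \<psi>" "is_potential D \<psi> f1p a" for \<psi> a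
    unfolding u1 f2 f2p \<omega>22
    using moutard_step[OF f1 \<omega> nz that] moutard_sol_inverse nz by blast
  moreover have "conj_gen_analytic D u1 (moutard_conj_sol f1p \<omega>11 a \<psi>p)
      \<and> is_potential D f2 (moutard_conj_sol f1p \<omega>11 a \<psi>p) (\<lambda>z. - \<i> * (a z / \<omega>11 z))
      \<and> (\<forall>z\<in>D. moutard_conj_sol f2p \<omega>22 (\<lambda>z. - \<i> * (a z / \<omega>11 z))
           (moutard_conj_sol f1p \<omega>11 a \<psi>p) z = \<psi>p z)"
    if "conj_gen_analytic D u \<psi>p" "is_potential D f1 \<psi>p a" for \<psi>p a
    unfolding u1 f2 f2p \<omega>22 dual moutard_conj_sol_eq
    using moutard_step[OF f1p \<omega>' nz that(1)[unfolded conj_gen_analytic_iff]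
        that(2)[unfolded is_potential_commute[of D f1]]]
      moutard_sol_inverse nz is_potential_commute by blast
  ultimately show ?thesis
    unfolding Let_def by blast
qed

end
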